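(* For every fixed positive integer $t$: if $t\le5$ then $B_{\mathcal{F}_t}=O(n^{2t-1})$, and if $t>5$ then $B_{\mathcal{F}_t}=O(n^{10}\log^2 n)$.
   Context: Identify $\{0,1\}$ with $\mathbb{F}_2$. $\ell(x)=\sum_k x_k$ (real sum). For distinct $i,j\in\{1,\dots,n\}$, the elementary transvection $\tau_{ij}:\mathbb{F}_2^n\to\mathbb{F}_2^n$ is the linear map with $(\tau_{ij}x)_i=x_i+x_j$ (mod 2) and other coordinates unchanged. $G_t$ is the set of all products of $t$ elementary transvections (repetitions allowed), and $\mathcal{F}_t=\{x\mapsto\ell(Mx+b): M\in G_t,\ b\in\mathbb{F}_2^n\}$ (computed over $\mathbb{F}_2$). For a class $\mathcal{C}$ of functions $\{0,1\}^n\to\mathbb{R}$, $B_{\mathcal{C}}=\inf_A\sup_{f\in\mathcal{C}}\mathbb{E}(T(A,f))$, where $A$ ranges over randomized black-box search algorithms and $T(A,f)$ is the number of evaluations until a global maximizer of $f$ is evaluated for the first time. *)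

theory Defs
  imports "HOL-Probability.Probability"
begin

text \<open>Points of {0,1}^n are boolean lists of length n (True = 1), coordinates indexed 0..<n.\<close>

definition cube :: "nat \<Rightarrow> bool list set" where
  "cube n = {x. length x = n}"

definition transv :: "nat \<Rightarrow> nat \<Rightarrow> bool list \<Rightarrow> bool list" where
  "transv i j x = x[i := (x ! i \<noteq> x ! j)]"

definition Gt :: "nat \<Rightarrow> nat \<Rightarrow> (bool list \<Rightarrow> bool list) set" where
  "Gt n t = {foldr (\<lambda>(i,j) g. transv i j \<circ> g) ps id | ps.
              length ps = t \<and> (\<forall>(i,j)\<in>set ps. i < n \<and> j < n \<and> i \<noteq> j)}"

definition ell :: "bool list \<Rightarrow> real" where
  "ell x = real (length (filter id x))"

definition Ft :: "nat \<Rightarrow> nat \<Rightarrow> (bool list \<Rightarrow> real) set" where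
  "Ft n t = {(\<lambda>x. ell (map2 (\<noteq>) (M x) b)) | M b. M \<in> Gt n t \<and> b \<in> cube n}"

text \<open>A randomized black-box algorithm: given the history of (query, value) pairs so far,
  it chooses the next query according to a probability distribution.\<close>
type_synonym algo = "(bool list \<times> real) list \<Rightarrow> bool list pmf"

definition valid_algo :: "nat \<Rightarrow> algo \<Rightarrow> bool" where
  "valid_algo n A \<longleftrightarrow> (\<forall>h. set_pmf (A h) \<subseteq> cube n)"

primrec hist :: "algo \<Rightarrow> (bool list \<Rightarrow> real) \<Rightarrow> nat \<Rightarrow> (bool list \<times> real) list pmf" where
  "hist A f 0 = return_pmf []"
| "hist A f (Suc k) = bind_pmf (hist A f k) (\<lambda>h. map_pmf (\<lambda>x. h @ [(x, f x)]) (A h))"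

definition is_max :: "nat \<Rightarrow> (bool list \<Rightarrow> real) \<Rightarrow> bool list \<Rightarrow> bool" where
  "is_max n f x \<longleftrightarrow> x \<in> cube n \<and> (\<forall>y\<in>cube n. f y \<le> f x)"

text \<open>E(T(A,f)) via the tail-sum formula E T = sum_{k>=0} P(T > k), where T > k means that
  none of the first k queries is a global maximizer (value may be infinite).\<close>
definition runtime :: "nat \<Rightarrow> algo \<Rightarrow> (bool list \<Rightarrow> real) \<Rightarrow> ennreal" where
  "runtime n A f = (\<Sum>k. ennreal (measure_pmf.prob (hist A f k)
                        {h. \<forall>(x,v)\<in>set h. \<not> is_max n f x}))"

definition BBC :: "nat \<Rightarrow> (bool list \<Rightarrow> real) set \<Rightarrow> ennreal" where
  "BBC n C = (INF A\<in>{A. valid_algo n A}. SUP f\<in>C. runtime n A f)"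

end

theory Submission
  imports Defs
begin

text \<open>
  In fact \<open>BBC n (Ft n t)\<close> is \<open>O(n)\<close> for every fixed \<open>t\<close>. The \<open>t\<close> transvections touch a set of at most
  \<open>2 * t\<close> coordinates, and in every other coordinate \<open>i\<close> the function depends on \<open>x ! i\<close> only
  through the additive term \<open>x ! i + b ! i\<close> (mod 2). Hence the difference of two functions of the class
  either changes under every flip of some fixed coordinate, or depends on at most \<open>4 * t\<close> coordinates; if it
  does not vanish identically, it is therefore nonzero on a fraction of at least \<open>1 / 2 ^ (4 * t + 1)\<close> of
  the cube. The class has only \<open>2 ^ O(n)\<close> members, so by averaging there are \<open>O(n)\<close> fixed queries
  which separate any two members. After these queries the function is known, and one more query hits a maximizer.
\<close>

section \<open>The cube and existence of maximizers\<close>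

lemma finite_cube [simp]: "finite (cube n)"
  and card_cube: "card (cube n) = 2 ^ n"
  using finite_lists_length_eq[of "UNIV :: bool set" n] card_lists_length_eq[of "UNIV :: bool set" n]
  by (simp_all add: cube_def)

lemma ex_is_max: "\<exists>x. is_max n f x"
proof -
  have "cube n \<noteq> {}"
    using card_cube[of n] by auto
  then have "Max (f ` cube n) \<in> f ` cube n"
    by (intro Max_in) auto
  then obtain x where "x \<in> cube n" "f x = Max (f ` cube n)"
    by (metis imageE)
  then show ?thesis
    by (auto simp: is_max_def)
qed

section \<open>From averaging to separating queries, and from these to an algorithm\<close>

text \<open>Greedy choice: averaging over \<open>X\<close> gives a point that misses at most a
  fraction \<open>q\<close> of the pairs still unhit, so each new query shrinks their number by the
  factor \<open>q\<close>.\<close>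

lemma ex_separating_list:
  fixes q :: real
  assumes "finite X" "X \<noteq> {}" "finite P" "0 \<le> q"
    and miss: "\<And>p. p \<in> P \<Longrightarrow> real (card {x\<in>X. \<not> hit p x}) \<le> q * real (card X)"
  shows "\<exists>Q. length Q = m \<and> set Q \<subseteq> X \<and>
           real (card {p\<in>P. \<forall>x\<in>set Q. \<not> hit p x}) \<le> q ^ m * real (card P)"
proof (induction m)
  case 0
  show ?case by (intro exI[of _ "[]"]) simp
next
  case (Suc m)
  then obtain Q where Q: "length Q = m" "set Q \<subseteq> X"
    "real (card {p\<in>P. \<forall>x\<in>set Q. \<not> hit p x}) \<le> q ^ m * real (card P)"
    by blast
  define R where "R = {p\<in>P. \<forall>x\<in>set Q. \<not> hit p x}"
  have fR: "finite R" using assms(3) by (simp add: R_def)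
  \<comment> \<open>Double counting of the misses in \<open>R\<close> and \<open>X\<close>; were
    every \<open>x\<close> above the average bound, the strict sum would contradict it.\<close>
  have "(\<Sum>x\<in>X. real (card {p\<in>R. \<not> hit p x})) = (\<Sum>x\<in>X. \<Sum>p\<in>R. of_bool (\<not> hit p x))"
    using fR by (simp add: Int_def)
  also have "\<dots> = (\<Sum>p\<in>R. \<Sum>x\<in>X. of_bool (\<not> hit p x))"
    by (rule sum.swap)
  also have "\<dots> = (\<Sum>p\<in>R. real (card {x\<in>X. \<not> hit p x}))"
    using assms(1) by (simp add: Int_def)
  also have "\<dots> \<le> (\<Sum>p\<in>R. q * real (card X))"
    by (intro sum_mono miss) (simp add: R_def)
  also have "\<dots> = (\<Sum>x\<in>X. q * real (card R))"
    by simp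
  finally obtain x where x: "x \<in> X" "real (card {p\<in>R. \<not> hit p x}) \<le> q * real (card R)"
    using sum_strict_mono[OF assms(1,2)] by (meson not_le)
  have "q * real (card R) \<le> q * (q ^ m * real (card P))"
    using Q(3) assms(4) by (intro mult_left_mono) (simp_all add: R_def)
  moreover have "{p\<in>P. \<forall>y\<in>set (x # Q). \<not> hit p y} = {p\<in>R. \<not> hit p x}"
    by (auto simp: R_def)
  ultimately show ?case
    using x Q(1,2) by (intro exI[of _ "x # Q"]) (simp add: mult.assoc)
qed

text \<open>Ask all of \<open>Q\<close>, then a maximizer of any member of \<open>C\<close>
  consistent with the answers. By \<open>sep\<close> that member agrees with \<open>f\<close> on the
  cube, so the last query maximizes \<open>f\<close>.\<close>

lemma BBC_le_of_separating_list:
  assumes Q: "set Q \<subseteq> cube n"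
    and sep: "\<And>f g. f \<in> C \<Longrightarrow> g \<in> C \<Longrightarrow> \<forall>x\<in>set Q. f x = g x \<Longrightarrow> \<forall>x\<in>cube n. f x = g x"
  shows "BBC n C \<le> ennreal (real (length Q + 1))"
proof -
  define cand where "cand h x \<longleftrightarrow> (\<exists>f\<in>C. (\<forall>(y,v)\<in>set h. f y = v) \<and> is_max n f x)"
    for h :: "(bool list \<times> real) list" and x
  \<comment> \<open>The default \<open>replicate n False\<close> occurs only for histories that no
    member of \<open>C\<close> explains; it keeps the algorithm valid on them.\<close>
  define next_query where "next_query h =
      (if length h < length Q then Q ! length h
       else if Ex (cand h) then SOME x. cand h x else replicate n False)" for h
  define A :: algo where "A h = return_pmf (next_query h)" for h
  have set_A: "set_pmf (A h) = {next_query h}" for h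
    by (simp add: A_def)
  have "next_query h \<in> cube n" for h
  proof (cases "length h < length Q")
    case True
    then show ?thesis using Q by (auto simp: next_query_def)
  next
    case False
    have "x \<in> cube n" if "cand h x" for x
      using that by (auto simp: cand_def is_max_def)
    then show ?thesis
      using False someI_ex[of "cand h"] by (simp add: next_query_def) (simp add: cube_def)
  qed
  then have valid: "valid_algo n A"
    by (simp add: valid_algo_def set_A)
  have "runtime n A f \<le> ennreal (real (length Q + 1))" if f: "f \<in> C" for f
  proof -
    define m where "m = length Q"
    have init: "hist A f k = return_pmf (map (\<lambda>x. (x, f x)) (take k Q))" if "k \<le> m" for k
      using that
      by (induction k)
        (simp_all add: bind_return_pmf A_def next_query_def m_def take_Suc_conv_app_nth)
    have hit: "\<exists>(x,v)\<in>set h. is_max n f x" if "h \<in> set_pmf (hist A f (Suc m + k))" for h k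
      using that
    proof (induction k arbitrary: h)
      case 0
      define h0 where "h0 = map (\<lambda>x. (x, f x)) Q"
      obtain x where "is_max n f x"
        using ex_is_max by blast
      \<comment> \<open>\<open>f\<close> itself explains the true history, so the default is not
        taken.\<close>
      then have "cand h0 x"
        using f by (auto simp: cand_def h0_def)
      then have ex: "Ex (cand h0)" ..
      have "cand h0 (next_query h0)"
        using ex someI_ex[OF ex] by (simp add: next_query_def h0_def)
      then obtain g where g: "g \<in> C" "\<forall>x\<in>set Q. g x = f x" "is_max n g (next_query h0)"
        by (auto simp: cand_def h0_def)
      then have "is_max n f (next_query h0)"
        using sep[OF g(1) f g(2)] by (auto simp: is_max_def)
      moreover have "h = h0 @ [(next_query h0, f (next_query h0))]"
        using 0 init[of m] by (simp add: set_A bind_return_pmf h0_def m_def)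
      ultimately show ?case by auto
    next
      case (Suc k)
      then obtain h' y where "h' \<in> set_pmf (hist A f (Suc m + k))" "h = h' @ [y]"
        using hist.simps(2)[of A f "Suc m + k"] by (auto simp del: hist.simps)
      with Suc.IH[of h'] show ?case by auto
    qed
    have zero: "measure_pmf.prob (hist A f k) {h. \<forall>(x,v)\<in>set h. \<not> is_max n f x} = 0"
      if "k \<notin> {..m}" for k
    proof -
      from that obtain j where "k = Suc m + j"
        by (metis atMost_iff le_add_diff_inverse not_less_eq_eq)
      with hit[of _ j] show ?thesis
        by (subst measure_pmf_zero_iff) fastforce
    qed
    \<comment> \<open>The tail probabilities vanish from \<open>Suc m\<close> on, which leaves
      \<open>m + 1\<close> terms, each at most 1.\<close>
    have "runtime n A f = (\<Sum>k\<le>m. ennreal (measure_pmf.prob (hist A f k)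
                             {h. \<forall>(x,v)\<in>set h. \<not> is_max n f x}))"
      unfolding runtime_def by (rule suminf_finite) (use zero in auto)
    also have "\<dots> \<le> (\<Sum>k\<le>m. 1)"
      by (intro sum_mono) simp
    also have "\<dots> = ennreal (real (m + 1))"
      by (simp add: ennreal_of_nat_eq_real_of_nat[symmetric])
    finally show ?thesis by (simp add: m_def)
  qed
  then show ?thesis
    unfolding BBC_def using valid by (intro INF_lower2[of A] SUP_least) auto
qed

section \<open>Words of transvections and the coordinates they leave alone\<close>

definition transvs :: "(nat \<times> nat) list \<Rightarrow> bool list \<Rightarrow> bool list" where
  "transvs ps = foldr (\<lambda>(i,j) g. transv i j \<circ> g) ps id"

text \<open>Coding members of the class by a word and a shift lets them be counted and exposes the
  coordinates involved.\<close>

definition ft_fun :: "(nat \<times> nat) list \<Rightarrow> bool list \<Rightarrow> bool list \<Rightarrow> real" where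
  "ft_fun ps b x = ell (map2 (\<noteq>) (transvs ps x) b)"

text \<open>Sources count as well as targets, so an untouched coordinate neither changes nor
  influences another one.\<close>

definition touched :: "(nat \<times> nat) list \<Rightarrow> nat set" where
  "touched ps = fst ` set ps \<union> snd ` set ps"

lemma finite_touched [simp]: "finite (touched ps)"
  by (simp add: touched_def)

lemma card_touched: "card (touched ps) \<le> 2 * length ps"
proof -
  have "card (touched ps) \<le> card (fst ` set ps) + card (snd ` set ps)"
    unfolding touched_def by (rule card_Un_le)
  also have "\<dots> \<le> card (set ps) + card (set ps)"
    by (intro add_mono card_image_le) auto
  finally show ?thesis using card_length[of ps] by simp
qed

lemma transvs_Nil [simp]: "transvs [] x = x"
  and transvs_Cons [simp]: "transvs (p # ps) x = transv (fst p) (snd p) (transvs ps x)"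
  by (simp_all add: transvs_def split_beta)

lemma length_transvs [simp]: "length (transvs ps x) = length x"
  by (induction ps) (simp_all add: transv_def)

lemma transvs_nth_untouched: "i \<notin> touched ps \<Longrightarrow> transvs ps x ! i = x ! i"
  by (induction ps) (auto simp: transv_def touched_def)

lemma transvs_update_untouched: "i \<notin> touched ps \<Longrightarrow> transvs ps (x[i := c]) = (transvs ps x)[i := c]"
proof (induction ps)
  case (Cons p ps)
  then have "i \<noteq> fst p" "i \<noteq> snd p" "transvs ps (x[i := c]) = (transvs ps x)[i := c]"
    by (auto simp: touched_def)
  then show ?case
    by (simp add: transv_def list_update_swap[of i])
qed simp

lemma ell_update:
  "i < length x \<Longrightarrow> ell (x[i := c]) = ell x - of_bool (x ! i) + of_bool c"
proof (induction x arbitrary: i)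
  case (Cons a x)
  then show ?case by (cases i) (auto simp: ell_def)
qed simp

text \<open>An untouched coordinate enters only its own summand of \<open>ell\<close>, and the
  update replaces that summand.\<close>

lemma ft_fun_update:
  assumes "i \<notin> touched ps" "i < n" "x \<in> cube n" "b \<in> cube n"
  shows "ft_fun ps b (x[i := c]) = ft_fun ps b x - of_bool (x ! i \<noteq> b ! i) + of_bool (c \<noteq> b ! i)"
proof -
  have "map2 (\<noteq>) ((transvs ps x)[i := c]) b = (map2 (\<noteq>) (transvs ps x) b)[i := (c \<noteq> b ! i)]"
    using zip_update[of "transvs ps x" i c b "b ! i"] by (simp add: map_update)
  then show ?thesis
    using assms by (simp add: ft_fun_def transvs_update_untouched ell_update transvs_nth_untouched cube_def)
qed

section \<open>How often two distinct members differ\<close>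

text \<open>The flip of coordinate \<open>i\<close> injects the zeros of \<open>D\<close> into its
  nonzeros.\<close>

lemma card_cube_le_flip:
  fixes D :: "bool list \<Rightarrow> real"
  assumes "i < n" and D: "\<And>x. x \<in> cube n \<Longrightarrow> D (x[i := \<not> x ! i]) \<noteq> D x"
  shows "2 ^ n \<le> 2 * card {x\<in>cube n. D x \<noteq> 0}"
proof -
  let ?N = "{x\<in>cube n. D x \<noteq> 0}" and ?Z = "{x\<in>cube n. D x = 0}"
  define flip where "flip x = x[i := \<not> x ! i]" for x :: "bool list"
  have "flip (flip x) = x" if "x \<in> cube n" for x
    using that assms(1) by (simp add: flip_def cube_def)
  then have "inj_on flip ?Z"
    by (intro inj_on_inverseI[of _ flip]) simp
  moreover have "flip ` ?Z \<subseteq> ?N"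
    using D by (fastforce simp: flip_def cube_def)
  ultimately have "card ?Z \<le> card ?N"
    by (intro card_inj_on_le[of flip]) auto
  moreover have "card (cube n) = card ?N + card ?Z"
    by (subst card_Un_disjoint[symmetric]) (auto intro: arg_cong[where f = card])
  ultimately show ?thesis by (simp add: card_cube)
qed

text \<open>Replacing the \<open>U\<close> bits of any \<open>y\<close> by those of
  \<open>x0\<close> yields a nonzero of \<open>D\<close>. The lost bits together with the new point
  determine \<open>y\<close>, so each nonzero arises at most \<open>2 ^ card U\<close>
  times.\<close>

lemma card_cube_le_junta:
  fixes D :: "bool list \<Rightarrow> real"
  assumes "finite U" and x0: "x0 \<in> cube n" "D x0 \<noteq> 0"
    and D: "\<And>x i c. x \<in> cube n \<Longrightarrow> i < n \<Longrightarrow> i \<notin> U \<Longrightarrow> D (x[i := c]) = D x"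
  shows "2 ^ n \<le> 2 ^ card U * card {x\<in>cube n. D x \<noteq> 0}"
proof -
  let ?N = "{x\<in>cube n. D x \<noteq> 0}"
  \<comment> \<open>Hybrids that lead from \<open>x0\<close> to the full replacement one coordinate
    at a time, since \<open>D\<close> is controlled only under single updates.\<close>
  define merge where "merge k y = map (\<lambda>i. if i \<in> U \<or> k \<le> i then x0 ! i else y ! i) [0..<n]" for k y
  have "D (merge k y) = D x0" if "k \<le> n" for k y
    using that
  proof (induction k)
    case 0
    have "merge 0 y = x0"
      using x0 by (auto simp: merge_def cube_def intro: nth_equalityI)
    then show ?case by simp
  next
    case (Suc k)
    show ?case
    proof (cases "k \<in> U")
      case True
      then have "merge (Suc k) y = merge k y"
        by (auto simp: merge_def Suc_le_eq le_less)
      with Suc show ?thesis by simp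
    next
      case False
      have "merge (Suc k) y = (merge k y)[k := y ! k]"
        using Suc.prems False by (intro nth_equalityI) (auto simp: merge_def nth_list_update)
      with Suc False show ?thesis
        by (simp add: D merge_def cube_def)
    qed
  qed
  then have merge: "merge n y \<in> ?N" for y
    using x0 by (simp add: merge_def cube_def)
  have "inj_on (\<lambda>y. ({i\<in>U. y ! i}, merge n y)) (cube n)"
  proof (rule inj_onI)
    fix y z
    assume yz: "y \<in> cube n" "z \<in> cube n" and eq: "({i\<in>U. y ! i}, merge n y) = ({i\<in>U. z ! i}, merge n z)"
    have "y ! i = z ! i" if "i < n" for i
    proof (cases "i \<in> U")
      case True
      then show ?thesis using eq by auto
    next
      case False
      have "merge n y ! i = merge n z ! i" using eq by simp
      then show ?thesis using False that by (simp add: merge_def)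
    qed
    with yz show "y = z" by (simp add: cube_def nth_equalityI)
  qed
  then have "card (cube n) \<le> card (Pow U \<times> ?N)"
    by (rule card_inj_on_le) (use merge assms(1) in auto)
  then show ?thesis
    using assms(1) by (simp add: card_cube card_cartesian_product card_Pow)
qed

lemma card_ft_fun_differ:
  assumes "b \<in> cube n" "b' \<in> cube n" "length ps = t" "length ps' = t"
    and "x0 \<in> cube n" "ft_fun ps b x0 \<noteq> ft_fun ps' b' x0"
  shows "2 ^ n \<le> 2 ^ (4 * t + 1) * card {x\<in>cube n. ft_fun ps b x \<noteq> ft_fun ps' b' x}"
proof -
  define D where "D x = ft_fun ps b x - ft_fun ps' b' x" for x
  define U where "U = touched ps \<union> touched ps'"
  have N: "{x\<in>cube n. ft_fun ps b x \<noteq> ft_fun ps' b' x} = {x\<in>cube n. D x \<noteq> 0}"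
    by (simp add: D_def)
  have "card U \<le> 4 * t"
    using card_touched[of ps] card_touched[of ps'] card_Un_le[of "touched ps" "touched ps'"] assms(3,4)
    by (simp add: U_def)
  have upd: "D (x[i := c]) = D x - of_bool (x ! i \<noteq> b ! i) + of_bool (c \<noteq> b ! i)
               + of_bool (x ! i \<noteq> b' ! i) - of_bool (c \<noteq> b' ! i)"
    if "x \<in> cube n" "i < n" "i \<notin> U" for x i c
    using that assms(1,2) by (simp add: D_def U_def ft_fun_update[of i _ n])
  show ?thesis
  \<comment> \<open>If the shifts differ at an untouched \<open>i\<close>, flipping \<open>i\<close>
    changes \<open>D\<close> by 2 or -2. Otherwise the terms in \<open>upd\<close> cancel and
    \<open>D\<close> depends on \<open>U\<close> only. The exponent \<open>4 * t + 1\<close> covers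
    both cases, also for \<open>t = 0\<close>.\<close>
  proof (cases "\<exists>i<n. i \<notin> U \<and> b ! i \<noteq> b' ! i")
    case True
    then obtain i where i: "i < n" "i \<notin> U" "b ! i \<noteq> b' ! i" by blast
    have "2 ^ n \<le> 2 * card {x\<in>cube n. D x \<noteq> 0}"
      using i by (intro card_cube_le_flip[of i]) (auto simp: upd)
    also have "\<dots> \<le> 2 ^ (4 * t + 1) * card {x\<in>cube n. D x \<noteq> 0}"
      by (intro mult_right_mono) auto
    finally show ?thesis by (simp only: N)
  next
    case False
    have "2 ^ n \<le> 2 ^ card U * card {x\<in>cube n. D x \<noteq> 0}"
      by (rule card_cube_le_junta[of _ x0]) (use False assms(5,6) in \<open>auto simp: upd\<close>, auto simp: U_def D_def)
    also have "\<dots> \<le> 2 ^ (4 * t + 1) * card {x\<in>cube n. D x \<noteq> 0}"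
      using \<open>card U \<le> 4 * t\<close> by (intro mult_right_mono power_increasing) auto
    finally show ?thesis by (simp only: N)
  qed
qed

section \<open>The linear bound and its consequences\<close>

lemma BBC_Ft_linear:
  assumes "n \<ge> 1"
  shows "BBC n (Ft n t) \<le> ennreal (real (2 ^ (4 * t + 1) * (4 * t + 2) + 1) * real n)"
proof -
  define K where "K = 4 * t + 1"
  define I where "I = {ps. set ps \<subseteq> {..<n} \<times> {..<n} \<and> length ps = t} \<times> cube n"
  define hit where "hit = (\<lambda>((ps, b), (ps', b')) x. ft_fun ps b x \<noteq> ft_fun ps' b' x)"
  \<comment> \<open>Different codes may give the same function on the cube; only pairs that some
    query can separate are kept.\<close>
  define P where "P = {p\<in>I \<times> I. \<exists>x\<in>cube n. hit p x}"
  \<comment> \<open>Chosen so that \<open>q ^ m\<close> is at most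
    \<open>exp (- real ((4 * t + 2) * n))\<close>, while \<open>P\<close> has at most
    \<open>2 ^ ((4 * t + 2) * n)\<close> elements.\<close>
  define m where "m = 2 ^ K * (4 * t + 2) * n"
  define q :: real where "q = 1 - 1 / 2 ^ K"
  have finI: "finite I"
    by (simp add: I_def finite_lists_length_eq)
  have "card I = (n * n) ^ t * 2 ^ n"
    by (simp add: I_def card_cartesian_product card_lists_length_eq card_cube)
  \<comment> \<open>The crude bound \<open>n < 2 ^ n\<close> keeps the exponent linear in
    \<open>n\<close>.\<close>
  also have "\<dots> \<le> (2 ^ n * 2 ^ n) ^ t * 2 ^ n"
    by (intro mult_right_mono power_mono mult_mono less_imp_le[OF less_exp]) auto
  also have "\<dots> = 2 ^ ((2 * t + 1) * n)"
    by (simp add: power_add[symmetric] power_mult[symmetric] algebra_simps)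
  finally have cI: "card I \<le> 2 ^ ((2 * t + 1) * n)" .
  have "card P \<le> card (I \<times> I)"
    unfolding P_def by (intro card_mono) (use finI in auto)
  also have "\<dots> \<le> 2 ^ ((2 * t + 1) * n) * 2 ^ ((2 * t + 1) * n)"
    unfolding card_cartesian_product by (intro mult_mono cI) auto
  also have "\<dots> = 2 ^ ((4 * t + 2) * n)"
    by (simp add: power_add[symmetric] algebra_simps)
  finally have "card P \<le> 2 ^ ((4 * t + 2) * n)" .
  from of_nat_mono[OF this, where 'a = real]
  have cP: "real (card P) \<le> 2 ^ ((4 * t + 2) * n)"
    by (simp only: of_nat_power of_nat_numeral)
  have miss: "real (card {x\<in>cube n. \<not> hit p x}) \<le> q * real (card (cube n))" if "p \<in> P" for p
  proof -
    obtain ps b ps' b' where p: "p = ((ps, b), (ps', b'))"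
      by (cases p) auto
    have "2 ^ n \<le> 2 ^ K * card {x\<in>cube n. hit p x}"
      using that card_ft_fun_differ[of b n b' ps t ps']
      by (auto simp: p P_def I_def hit_def K_def)
    from of_nat_mono[OF this, where 'a = real]
    have "(2::real) ^ n \<le> 2 ^ K * real (card {x\<in>cube n. hit p x})"
      by simp
    moreover have "card (cube n) = card {x\<in>cube n. hit p x} + card {x\<in>cube n. \<not> hit p x}"
      by (subst card_Un_disjoint[symmetric]) (auto intro: arg_cong[where f = card])
    from arg_cong[OF this, of real]
    have "(2::real) ^ n = real (card {x\<in>cube n. hit p x}) + real (card {x\<in>cube n. \<not> hit p x})"
      by (simp add: card_cube)
    ultimately show ?thesis
      by (simp add: q_def card_cube field_simps)
  qed
  have q: "0 \<le> q" by (simp add: q_def)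
  have ne: "cube n \<noteq> {}" using card_cube[of n] by auto
  have "finite P" using finI by (simp add: P_def)
  then obtain Q where Q: "length Q = m" "set Q \<subseteq> cube n"
    "real (card {p\<in>P. \<forall>x\<in>set Q. \<not> hit p x}) \<le> q ^ m * real (card P)"
    using ex_separating_list[of "cube n" P q hit m] ne q miss by auto
  have "q ^ m \<le> exp (- (1 / 2 ^ K)) ^ m"
    using exp_ge_add_one_self[of "- (1 / 2 ^ K)"] q by (intro power_mono) (simp_all add: q_def)
  also have "\<dots> = exp (- real ((4 * t + 2) * n))"
    by (simp add: exp_of_nat_mult[symmetric] m_def field_simps)
  also have "\<dots> = 1 / exp 1 ^ ((4 * t + 2) * n)"
    using exp_of_nat_mult[of "(4 * t + 2) * n" "1::real"]
    by (simp only: exp_minus inverse_eq_divide mult_1_right)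
  finally have "q ^ m * real (card P) \<le> 1 / exp 1 ^ ((4 * t + 2) * n) * 2 ^ ((4 * t + 2) * n)"
    using cP by (intro mult_mono) auto
  also have "\<dots> < 1"
  proof -
    \<comment> \<open>The Taylor bound gives \<open>exp 1 \<ge> 5/2\<close>;
      \<open>n \<ge> 1\<close> makes the exponent positive and the inequality strict.\<close>
    have "(2::real) ^ ((4 * t + 2) * n) < exp 1 ^ ((4 * t + 2) * n)"
      using assms exp_lower_Taylor_quadratic[of "1::real"] by (intro power_strict_mono) simp_all
    then show ?thesis by simp
  qed
  finally have "q ^ m * real (card P) < 1" .
  \<comment> \<open>A cardinality below 1 is 0, so \<open>Q\<close> separates every pair in
    \<open>P\<close>.\<close>
  with Q(3) have "card {p\<in>P. \<forall>x\<in>set Q. \<not> hit p x} = 0" by linarith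
  then have none: "{p\<in>P. \<forall>x\<in>set Q. \<not> hit p x} = {}"
    using \<open>finite P\<close> by simp
  have Ft: "\<exists>(ps, b)\<in>I. f = ft_fun ps b" if "f \<in> Ft n t" for f
    using that by (fastforce simp: Ft_def Gt_def I_def ft_fun_def transvs_def)
  have "BBC n (Ft n t) \<le> ennreal (real (length Q + 1))"
  proof (rule BBC_le_of_separating_list[OF Q(2)])
    fix f g assume fg: "f \<in> Ft n t" "g \<in> Ft n t" "\<forall>x\<in>set Q. f x = g x"
    obtain ps b ps' b' where p: "(ps, b) \<in> I" "(ps', b') \<in> I" "f = ft_fun ps b" "g = ft_fun ps' b'"
      using Ft[OF fg(1)] Ft[OF fg(2)] by auto
    then have "((ps, b), (ps', b')) \<notin> P"
      using none fg(3) by (fastforce simp: hit_def)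
    then show "\<forall>x\<in>cube n. f x = g x"
      using p by (auto simp: P_def hit_def)
  qed
  also have "\<dots> \<le> ennreal (real (2 ^ (4 * t + 1) * (4 * t + 2) + 1) * real n)"
    using assms by (intro ennreal_leI) (simp add: Q(1) m_def K_def algebra_simps)
  finally show ?thesis .
qed

theorem theorem6:
  fixes t :: nat
  assumes "t \<ge> 1"
  shows "(t \<le> 5 \<longrightarrow> (\<exists>c::real. \<exists>N::nat. \<forall>n\<ge>N.
            BBC n (Ft n t) \<le> ennreal (c * real n ^ (2 * t - 1))))
       \<and> (t > 5 \<longrightarrow> (\<exists>c::real. \<exists>N::nat. \<forall>n\<ge>N.
            BBC n (Ft n t) \<le> ennreal (c * real n ^ 10 * (ln (real n)) ^ 2)))"
proof -
  define c where "c = real (2 ^ (4 * t + 1) * (4 * t + 2) + 1)"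
  have c: "c \<ge> 0" by (simp add: c_def)
  \<comment> \<open>From 3 on, \<open>ln (real n)\<close> is at least 1, so the logarithmic factor
    only enlarges the bound.\<close>
  have lin: "BBC n (Ft n t) \<le> ennreal (c * real n)" if "n \<ge> 3" for n
    using BBC_Ft_linear[of n t] that by (simp only: c_def)
  have "BBC n (Ft n t) \<le> ennreal (c * real n ^ (2 * t - 1))" if "n \<ge> 3" for n
  proof -
    have "real n ^ 1 \<le> real n ^ (2 * t - 1)"
      using that assms by (intro power_increasing) auto
    then have "ennreal (c * real n) \<le> ennreal (c * real n ^ (2 * t - 1))"
      using c by (intro ennreal_leI mult_left_mono) auto
    with lin[OF that] show ?thesis by (rule order_trans)
  qed
  moreover have "BBC n (Ft n t) \<le> ennreal (c * real n ^ 10 * (ln (real n)) ^ 2)" if "n \<ge> 3" for n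
  proof -
    have "1 \<le> ln (real n)"
      using that e_less_272 by (subst ln_ge_iff) auto
    then have "1 \<le> (ln (real n))\<^sup>2" by simp
    moreover have "real n ^ 1 \<le> real n ^ 10"
      using that by (intro power_increasing) auto
    ultimately have "real n * 1 \<le> real n ^ 10 * (ln (real n))\<^sup>2"
      by (intro mult_mono) auto
    then have "ennreal (c * real n) \<le> ennreal (c * (real n ^ 10 * (ln (real n))\<^sup>2))"
      using c by (intro ennreal_leI mult_left_mono) auto
    with lin[OF that] show ?thesis by (simp add: mult.assoc)
  qed
  ultimately show ?thesis by blast
qed

end
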